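(* Let $m\ge 2$, $1\le n\le m-1$ and $N\ge 2$ be integers, let $D=\binom{m+1}{2}-1=\frac{(m-1)(m+2)}{2}$, let $P_1,\dots,P_N\in G(m,n)$, and put $d_c^2=\min_{i\ne j}d_c(P_i,P_j)^2$, where $d_c(\cdot,\cdot)$ is the chordal distance. Let $\bar{\mathcal{P}}_1,\dots,\bar{\mathcal{P}}_N$ be the corresponding points on the sphere of radius $\sqrt{n(m-n)/m}$ centered at the origin in $\mathbb{R}^D$. (i) (Simplex bound) $$d_c^2\le\frac{n(m-n)}{m}\cdot\frac{N}{N-1}.$$ Equality requires $N\le D+1=\binom{m+1}{2}$, and occurs if and only if the $N$ points $\bar{\mathcal{P}}_1,\dots,\bar{\mathcal{P}}_N$ in $\mathbb{R}^D$ form a regular equatorial simplex. (ii) (Orthoplex bound) If $N>\binom{m+1}{2}$, then $$d_c^2\le\frac{n(m-n)}{m}.$$ Equality (for $N>\binom{m+1}{2}$) requires $N\le 2D=(m-1)(m+2)$, and occurs if the $N$ points $\bar{\mathcal{P}}_1,\dots,\bar{\mathcal{P}}_N$ form a subset of the $2D$ vertices of a regular orthoplex. If $N=2D$ this condition is also necessary for equality.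
   Context: $G(m,n)$ denotes the set of all $n$-dimensional linear subspaces ("planes") of $\mathbb{R}^m$. Principal angles: for $P,Q\in G(m,n)$ the principal angles $\theta_1,\dots,\theta_n\in[0,\pi/2]$ are defined recursively by $\cos\theta_i=\max_{u\in P}\max_{v\in Q}u\cdot v=u_i\cdot v_i$ for $i=1,\dots,n$, the maximum being subject to $u\cdot u=v\cdot v=1$, $u\cdot u_j=0$, $v\cdot v_j=0$ for $1\le j\le i-1$. The chordal distance is $d_c(P,Q)=\sqrt{\sin^2\theta_1+\cdots+\sin^2\theta_n}$. Points corresponding to planes: for $P\in G(m,n)$ let $\mathcal{P}$ be the $m\times m$ matrix of the orthogonal projection of $\mathbb{R}^m$ onto $P$, and let $\bar{\mathcal{P}}=\mathcal{P}-\frac{n}{m}I_m$, where $I_m$ is the identity matrix. This is a point of the $D$-dimensional Euclidean space of real symmetric $m\times m$ matrices of trace $0$ with norm $\|M\|=\sqrt{\mathrm{trace}\,M^{tr}M}$, which is identified with $\mathbb{R}^D$. One has $\|\bar{\mathcal{P}}\|=\sqrt{n(m-n)/m}$ and $d_c(P,Q)=\frac{1}{\sqrt2}\|\bar{\mathcal{P}}-\bar{\mathcal{Q}}\|$. $N$ points on the sphere form a regular equatorial simplex if they are the $N$ vertices of a regular $(N-1)$-dimensional simplex (all pairwise distances equal and nonzero) whose centroid is the center of the sphere (the origin). A regular orthoplex (generalized octahedron, cross-polytope) here is one in $\mathbb{R}^D$ inscribed in the sphere: its $2D$ vertices are $\pm r e_1,\dots,\pm r e_D$ for some orthonormal basis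 $e_1,\dots,e_D$ of $\mathbb{R}^D$, with $r=\sqrt{n(m-n)/m}$. "The $N$ points form a subset" means that they are distinct vertices. *)

theory Defs
  imports "HOL-Analysis.Analysis"
begin

section \<open>Planes, principal angles and chordal distance\<close>

definition grassmannian :: "nat \<Rightarrow> 'a::euclidean_space set set" where
  "grassmannian n = {P. subspace P \<and> dim P = n}"

definition feasible_pairs ::
  "'a::euclidean_space set \<Rightarrow> 'a set \<Rightarrow> (nat \<Rightarrow> 'a) \<Rightarrow> (nat \<Rightarrow> 'a) \<Rightarrow> nat \<Rightarrow> ('a \<times> 'a) set" where
  "feasible_pairs P Q u v i =
     {(x, y). x \<in> P \<and> y \<in> Q \<and> x \<bullet> x = 1 \<and> y \<bullet> y = 1 \<and>
              (\<forall>j\<in>{1..<i}. x \<bullet> u j = 0 \<and> y \<bullet> v j = 0)}"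

definition principal_angles ::
  "nat \<Rightarrow> 'a::euclidean_space set \<Rightarrow> 'a set \<Rightarrow> (nat \<Rightarrow> real) \<Rightarrow> bool" where
  "principal_angles n P Q \<theta> \<longleftrightarrow>
     (\<exists>u v. \<forall>i\<in>{1..n}.
        0 \<le> \<theta> i \<and> \<theta> i \<le> pi / 2 \<and>
        (u i, v i) \<in> feasible_pairs P Q u v i \<and>
        cos (\<theta> i) = u i \<bullet> v i \<and>
        (\<forall>(x, y)\<in>feasible_pairs P Q u v i. x \<bullet> y \<le> u i \<bullet> v i))"

text \<open>The maximising vectors are not unique, but for \<open>n\<close>-dimensional \<open>P\<close> and \<open>Q\<close> the angles
  \<open>\<theta> 1, \<dots>, \<theta> n\<close> exist and do not depend on them. Only the values of \<open>\<theta>\<close> outside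
  \<open>{1..n}\<close> are left open, and these do not enter the sum.\<close>

definition chordal_dist :: "nat \<Rightarrow> 'a::euclidean_space set \<Rightarrow> 'a set \<Rightarrow> real" where
  "chordal_dist n P Q =
     (let \<theta> = (SOME \<theta>. principal_angles n P Q \<theta>) in sqrt (\<Sum>i=1..n. (sin (\<theta> i))\<^sup>2))"

section \<open>The points corresponding to planes\<close>

definition orth_proj :: "'a::euclidean_space set \<Rightarrow> 'a \<Rightarrow> 'a" where
  "orth_proj P x = (THE y. y \<in> P \<and> (\<forall>z\<in>P. orthogonal (x - y) z))"

definition plane_point :: "nat \<Rightarrow> (real^'m) set \<Rightarrow> real^'m^'m" where
  "plane_point n P = matrix (orth_proj P) - (real n / real CARD('m)) *\<^sub>R mat 1"

text \<open>The Euclidean space of symmetric matrices of trace \<open>0\<close>, of dimension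
  \<open>(CARD('m) + 1 choose 2) - 1\<close>, as a subspace of all matrices. The library norm on
  \<open>real^'m^'m\<close> is the Frobenius norm.\<close>

definition sym_traceless :: "(real^'m^'m) set" where
  "sym_traceless = {M. transpose M = M \<and> trace M = 0}"

lemma twice_ambient_dim:
  fixes m :: nat
  assumes "m \<ge> 2"
  shows "2 * (((m + 1) choose 2) - 1) = (m - 1) * (m + 2)"
proof -
  obtain k where k: "m = k + 2" using assms by (metis add.commute le_Suc_ex)
  have "even ((m + 1) * m)" by simp
  then have "2 * ((m + 1) choose 2) = (m + 1) * m" by (simp add: choose_two)
  then show ?thesis by (simp add: k algebra_simps)
qed

lemma norm_matrix_eq_sqrt_trace:
  fixes M :: "real^'m^'m"
  shows "norm M = sqrt (trace (transpose M ** M))"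
proof -
  have "M \<bullet> M = trace (transpose M ** M)"
    unfolding trace_def transpose_def matrix_matrix_mult_def inner_vec_def
    by (simp, rule sum.swap)
  then show ?thesis
    by (simp add: norm_eq_sqrt_inner)
qed

section \<open>Simplices and orthoplexes inscribed in a sphere centred at the origin\<close>

definition regular_equatorial_simplex ::
  "real \<Rightarrow> nat \<Rightarrow> (nat \<Rightarrow> 'a::euclidean_space) \<Rightarrow> bool" where
  "regular_equatorial_simplex r N x \<longleftrightarrow>
     (\<forall>i\<in>{1..N}. x i \<in> sphere 0 r) \<and>
     \<not> affine_dependent (x ` {1..N}) \<and>
     (\<exists>s>0. \<forall>i\<in>{1..N}. \<forall>j\<in>{1..N}. i \<noteq> j \<longrightarrow> dist (x i) (x j) = s) \<and>
     (1 / real N) *\<^sub>R (\<Sum>i=1..N. x i) = 0"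

definition orthonormal_basis ::
  "nat \<Rightarrow> 'a::euclidean_space set \<Rightarrow> (nat \<Rightarrow> 'a) \<Rightarrow> bool" where
  "orthonormal_basis D V e \<longleftrightarrow>
     (\<forall>i\<in>{1..D}. \<forall>j\<in>{1..D}. e i \<bullet> e j = (if i = j then 1 else 0)) \<and>
     span (e ` {1..D}) = V"

definition regular_orthoplex_vertices ::
  "real \<Rightarrow> nat \<Rightarrow> 'a::euclidean_space set \<Rightarrow> 'a set \<Rightarrow> bool" where
  "regular_orthoplex_vertices r D V W \<longleftrightarrow>
     (\<exists>e. orthonormal_basis D V e \<and> W = (\<Union>i\<in>{1..D}. {r *\<^sub>R e i, - (r *\<^sub>R e i)}))"

definition subset_of_regular_orthoplex ::
  "real \<Rightarrow> nat \<Rightarrow> 'a::euclidean_space set \<Rightarrow> nat \<Rightarrow> (nat \<Rightarrow> 'a) \<Rightarrow> bool" where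
  "subset_of_regular_orthoplex r D V N x \<longleftrightarrow>
     inj_on x {1..N} \<and> (\<exists>W. regular_orthoplex_vertices r D V W \<and> x ` {1..N} \<subseteq> W)"

end

theory Submission
  imports Defs
begin

text \<open>The principal vectors of two planes are orthonormal bases \<open>u\<close>, \<open>v\<close> with \<open>u i \<bullet> v j = 0\<close> for
  \<open>i \<noteq> j\<close>, so the inner product of the two projection matrices is \<open>\<Sum>i. (cos (\<theta> i))\<^sup>2\<close> and the
  squared chordal distance equals \<open>r\<^sup>2\<close> minus the inner product of the corresponding points. The
  bounds are thus Rankin's bounds for the largest inner product among \<open>N\<close> points on a sphere: the
  simplex bound because the sum of the points has nonnegative square, the orthoplex bound because
  at most \<open>D + 1\<close> vectors of a \<open>D\<close>-dimensional space have pairwise negative inner products and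
  at most \<open>2 * D\<close> nonzero ones have pairwise nonpositive inner products.\<close>

section \<open>Chordal distance and inner products\<close>

lemma orthonormal_imp_independent:
  fixes e :: "'i \<Rightarrow> 'a::euclidean_space"
  assumes "\<forall>i\<in>I. \<forall>j\<in>I. e i \<bullet> e j = (if i = j then 1 else 0)"
  shows "inj_on e I" "independent (e ` I)"
proof -
  show "inj_on e I"
    using assms by (metis inj_onI zero_neq_one)
  have "pairwise orthogonal (e ` I)"
    using assms by (auto simp: pairwise_def orthogonal_def)
  moreover have "0 \<notin> e ` I"
    using assms by (metis imageE inner_zero_left zero_neq_one)
  ultimately show "independent (e ` I)"
    by (rule pairwise_orthogonal_independent)
qed

text \<open>A dimension count replaces a proof of spanning: \<open>D\<close> independent vectors in
  a space of dimension at most \<open>D\<close> already span it.\<close>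

lemma orthonormal_basisI:
  fixes e :: "nat \<Rightarrow> 'a::euclidean_space"
  assumes on: "\<forall>i\<in>{1..D}. \<forall>j\<in>{1..D}. e i \<bullet> e j = (if i = j then 1 else 0)"
    and V: "subspace V" "dim V \<le> D" "\<forall>i\<in>{1..D}. e i \<in> V"
  shows "orthonormal_basis D V e"
proof -
  note ind = orthonormal_imp_independent[OF on]
  have sub: "e ` {1..D} \<subseteq> V" using V(3) by auto
  have "dim V \<le> card (e ` {1..D})"
    using ind(1) V(2) by (simp add: card_image)
  then have "V \<subseteq> span (e ` {1..D})"
    using card_ge_dim_independent[OF sub ind(2)] by simp
  moreover have "span (e ` {1..D}) \<subseteq> V"
    by (rule span_minimal[OF sub V(1)])
  ultimately show ?thesis
    using on by (simp add: orthonormal_basis_def)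
qed

section \<open>Projection matrices of planes and their inner products\<close>

lemma orth_proj_eq_sum:
  assumes "orthonormal_basis n P u"
  shows "orth_proj P x = (\<Sum>i=1..n. (x \<bullet> u i) *\<^sub>R u i)"
  unfolding orth_proj_def
proof (rule the_equality)
  let ?y = "\<Sum>i=1..n. (x \<bullet> u i) *\<^sub>R u i"
  have on: "\<forall>i\<in>{1..n}. \<forall>j\<in>{1..n}. u i \<bullet> u j = (if i = j then 1 else 0)"
    and P: "span (u ` {1..n}) = P"
    using assms by (auto simp: orthonormal_basis_def)
  have yP: "?y \<in> P"
    unfolding P[symmetric] by (intro span_sum span_scale span_base) auto
  have "orthogonal (x - ?y) (u j)" if j: "j \<in> {1..n}" for j
  proof -
    have "?y \<bullet> u j = (\<Sum>i=1..n. if i = j then x \<bullet> u i else 0)"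
      unfolding inner_sum_left using on j by (intro sum.cong) auto
    also have "\<dots> = x \<bullet> u j" using j by simp
    finally show ?thesis by (simp add: orthogonal_def inner_diff_left)
  qed
  then have "\<And>w. w \<in> u ` {1..n} \<Longrightarrow> orthogonal (x - ?y) w" by blast
  then have orth: "orthogonal (x - ?y) z" if "z \<in> P" for z
    using orthogonal_to_span that unfolding P[symmetric] by blast
  show "?y \<in> P \<and> (\<forall>z\<in>P. orthogonal (x - ?y) z)"
    using yP orth by blast
  fix y assume y: "y \<in> P \<and> (\<forall>z\<in>P. orthogonal (x - y) z)"
  \<comment> \<open>The difference of two candidates lies in \<open>P\<close>, and both residuals
    are orthogonal to it; subtracting, it is orthogonal to itself.\<close>
  have "y - ?y \<in> P"
    using y yP unfolding P[symmetric] by (intro span_diff) auto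
  then have "(x - ?y) \<bullet> (y - ?y) = 0" "(x - y) \<bullet> (y - ?y) = 0"
    using y orth by (auto simp: orthogonal_def)
  then have "(y - ?y) \<bullet> (y - ?y) = 0"
    by (simp add: inner_diff_left)
  then show "y = ?y" by simp
qed

lemma matrix_orth_proj:
  fixes u :: "nat \<Rightarrow> real^'m"
  assumes "orthonormal_basis n P u"
  shows "matrix (orth_proj P) $ a $ b = (\<Sum>i=1..n. u i $ a * u i $ b)"
  by (simp add: matrix_def orth_proj_eq_sum[OF assms] inner_axis' inner_axis
      mult.commute)

lemma inner_mat_1:
  fixes M :: "real^'m^'m"
  shows "M \<bullet> mat 1 = trace M"
  by (simp add: inner_vec_def mat_def trace_def if_distrib[where f = "\<lambda>t. _ * t"] cong: if_cong)

lemma trace_orth_proj: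
  fixes u :: "nat \<Rightarrow> real^'m"
  assumes "orthonormal_basis n P u"
  shows "trace (matrix (orth_proj P)) = real n"
proof -
  have "trace (matrix (orth_proj P)) = (\<Sum>i=1..n. u i \<bullet> u i)"
    by (simp add: trace_def matrix_orth_proj[OF assms] inner_vec_def) (rule sum.swap)
  also have "\<dots> = (\<Sum>i=1..n. 1)"
    using assms by (intro sum.cong) (auto simp: orthonormal_basis_def)
  finally show ?thesis by simp
qed

text \<open>Each projection matrix is a sum of rank-one matrices \<open>u u^T\<close> over an
  orthonormal basis, and the Frobenius product of \<open>u u^T\<close> and \<open>v v^T\<close> is
  the square of \<open>u \<bullet> v\<close>.\<close>

lemma inner_orth_proj:
  fixes u v :: "nat \<Rightarrow> real^'m"
  assumes u: "orthonormal_basis n P u" and v: "orthonormal_basis n Q v"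
  shows "matrix (orth_proj P) \<bullet> matrix (orth_proj Q) = (\<Sum>i=1..n. \<Sum>j=1..n. (u i \<bullet> v j)\<^sup>2)"
proof -
  have "matrix (orth_proj P) \<bullet> matrix (orth_proj Q) =
      (\<Sum>a\<in>UNIV. \<Sum>b\<in>UNIV. \<Sum>i=1..n. \<Sum>j=1..n. (u i $ a * u i $ b) * (v j $ a * v j $ b))"
    by (simp add: inner_vec_def matrix_orth_proj[OF u] matrix_orth_proj[OF v] sum_product)
  also have "\<dots> = (\<Sum>i=1..n. \<Sum>j=1..n. \<Sum>a\<in>UNIV. \<Sum>b\<in>UNIV. (u i $ a * u i $ b) * (v j $ a * v j $ b))"
  proof -
    have swap: "(\<Sum>a\<in>UNIV. \<Sum>i=1..n. \<Sum>j=1..n. f a i j) = (\<Sum>i=1..n. \<Sum>j=1..n. \<Sum>a\<in>UNIV. f a i j)"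
      for f :: "'m \<Rightarrow> nat \<Rightarrow> nat \<Rightarrow> real"
      by (subst sum.swap, rule sum.cong[OF refl], rule sum.swap)
    show ?thesis by (simp only: swap)
  qed
  also have "\<dots> = (\<Sum>i=1..n. \<Sum>j=1..n. (u i \<bullet> v j)\<^sup>2)"
    by (simp add: inner_vec_def power2_eq_square sum_product mult_ac)
  finally show ?thesis .
qed

lemma plane_point_in_sym_traceless:
  fixes u :: "nat \<Rightarrow> real^'m"
  assumes "orthonormal_basis n P u"
  shows "plane_point n P \<in> sym_traceless"
proof -
  have "transpose (plane_point n P) = plane_point n P"
    by (simp add: vec_eq_iff transpose_def plane_point_def matrix_orth_proj[OF assms] mat_def mult.commute)
  moreover have "trace (plane_point n P) = 0"
  proof -
    have "trace (plane_point n P) = trace (matrix (orth_proj P)) - real n / real CARD('m) * trace (mat 1 :: real^'m^'m)"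
      by (simp add: plane_point_def trace_def sum_subtractf sum_distrib_left)
    then show ?thesis by (simp add: trace_orth_proj[OF assms] trace_I)
  qed
  ultimately show ?thesis by (simp add: sym_traceless_def)
qed

text \<open>\<open>mat 1\<close> is orthogonal to every traceless matrix, so the shift of the second
  point contributes nothing, and that of the first contributes \<open>n / CARD('m)\<close> times the
  trace \<open>n\<close>.\<close>

lemma inner_plane_point:
  fixes u v :: "nat \<Rightarrow> real^'m"
  assumes u: "orthonormal_basis n P u" and v: "orthonormal_basis n Q v"
  shows "plane_point n P \<bullet> plane_point n Q
    = (\<Sum>i=1..n. \<Sum>j=1..n. (u i \<bullet> v j)\<^sup>2) - (real n)\<^sup>2 / real CARD('m)"
proof -
  have "plane_point n P \<bullet> plane_point n Q
      = plane_point n P \<bullet> matrix (orth_proj Q) - real n / real CARD('m) * trace (plane_point n P)"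
    by (subst (2) plane_point_def) (simp add: inner_diff_right inner_mat_1)
  also have "\<dots> = plane_point n P \<bullet> matrix (orth_proj Q)"
    using plane_point_in_sym_traceless[OF u] by (simp add: sym_traceless_def)
  also have "\<dots> = matrix (orth_proj P) \<bullet> matrix (orth_proj Q)
      - real n / real CARD('m) * trace (matrix (orth_proj Q))"
    by (simp add: plane_point_def inner_diff_left inner_mat_1 inner_commute[of "mat 1"])
  finally show ?thesis
    by (simp add: inner_orth_proj[OF u v] trace_orth_proj[OF v] power2_eq_square)
qed

section \<open>Principal angles and principal vectors\<close>

text \<open>The \<open>i - 1 < n\<close> earlier vectors cannot span an \<open>n\<close>-dimensional
  plane, so each plane has a unit vector orthogonal to them.\<close>

lemma feasible_pairs_nonempty:
  fixes P Q :: "'a::euclidean_space set"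
  assumes P: "P \<in> grassmannian n" and Q: "Q \<in> grassmannian n" and i: "i \<in> {1..n}"
    and u: "\<forall>j\<in>{1..<i}. u j \<in> P" and v: "\<forall>j\<in>{1..<i}. v j \<in> Q"
  shows "feasible_pairs P Q u v i \<noteq> {}"
proof -
  have ex: "\<exists>x\<in>R. x \<bullet> x = 1 \<and> (\<forall>j\<in>{1..<i}. x \<bullet> w j = 0)"
    if R: "R \<in> grassmannian n" and w: "\<forall>j\<in>{1..<i}. w j \<in> R"
    for R :: "'a set" and w :: "nat \<Rightarrow> 'a"
  proof -
    have sR: "subspace R" "dim R = n" using R by (auto simp: grassmannian_def)
    have sub: "span (w ` {1..<i}) \<subseteq> R" using w sR by (intro span_minimal) auto
    have "dim (span (w ` {1..<i})) \<le> card {1..<i}"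
      by (metis dim_span dim_le_card' card_image_le finite_imageI finite_atLeastLessThan order_trans)
    also have "\<dots> < n" using i by auto
    finally have "span (w ` {1..<i}) \<subset> span R"
      using sub sR by (metis psubsetI span_eq_iff order_less_irrefl)
    then obtain x where x: "x \<noteq> 0" "x \<in> span R" "\<And>y. y \<in> span (w ` {1..<i}) \<Longrightarrow> orthogonal x y"
      using orthogonal_to_subspace_exists_gen by blast
    have "x \<bullet> w j = 0" if "j \<in> {1..<i}" for j
      using x(3)[OF span_base] that by (auto simp: orthogonal_def)
    moreover have "x \<in> R" using x(2) sR(1) span_eq_iff by blast
    then have "sgn x \<in> R" "sgn x \<bullet> sgn x = 1"
      using x(1) sR(1) by (auto simp: sgn_div_norm subspace_scale dot_square_norm power2_eq_square)
    ultimately show ?thesis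
      by (intro bexI[of _ "sgn x"]) (auto simp: sgn_div_norm)
  qed
  from ex[OF P u] ex[OF Q v] show ?thesis
    unfolding feasible_pairs_def by fastforce
qed

lemma compact_feasible_pairs:
  fixes P Q :: "'a::euclidean_space set"
  assumes "subspace P" "subspace Q"
  shows "compact (feasible_pairs P Q u v i)"
proof -
  have "closed {z :: 'a \<times> 'a. \<forall>j. j \<in> {1..<i} \<longrightarrow> fst z \<bullet> u j = 0 \<and> snd z \<bullet> v j = 0}"
    by (intro closed_Collect_all closed_Collect_imp closed_Collect_conj closed_Collect_eq continuous_intros) auto
  then have "closed {z :: 'a \<times> 'a. \<forall>j\<in>{1..<i}. fst z \<bullet> u j = 0 \<and> snd z \<bullet> v j = 0}"
    by (simp add: Ball_def)
  moreover have "compact ((P \<inter> sphere 0 1) \<times> (Q \<inter> sphere 0 1))"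
    using assms by (intro compact_Times closed_Int_compact closed_subspace) auto
  moreover have "feasible_pairs P Q u v i = ((P \<inter> sphere 0 1) \<times> (Q \<inter> sphere 0 1)) \<inter>
      {z. \<forall>j\<in>{1..<i}. fst z \<bullet> u j = 0 \<and> snd z \<bullet> v j = 0}"
    by (auto simp: feasible_pairs_def norm_eq_1)
  ultimately show ?thesis by (simp only: compact_Int_closed)
qed

text \<open>The maximisers at stage \<open>i\<close> depend on those chosen before, so they come
  from a recursive choice; each maximum is attained because the feasible pairs form a nonempty
  compact set.\<close>

lemma principal_angles_exist:
  fixes P Q :: "'a::euclidean_space set"
  assumes P: "P \<in> grassmannian n" and Q: "Q \<in> grassmannian n"
  shows "\<exists>\<theta>. principal_angles n P Q \<theta>"
proof -
  \<comment> \<open>Nothing is demanded outside \<open>{1..n}\<close>, so that the choice can run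
    over all natural numbers.\<close>
  define good where "good w i z \<longleftrightarrow> (i \<in> {1..n} \<longrightarrow>
      z \<in> feasible_pairs P Q (fst \<circ> w) (snd \<circ> w) i \<and>
      (\<forall>(x, y)\<in>feasible_pairs P Q (fst \<circ> w) (snd \<circ> w) i. x \<bullet> y \<le> fst z \<bullet> snd z))"
    for w :: "nat \<Rightarrow> 'a \<times> 'a" and i z
  have "\<exists>w. \<forall>i. good w i (w i)"
  proof (rule dependent_wellorder_choice)
    fix z i and w w' :: "nat \<Rightarrow> 'a \<times> 'a"
    assume "\<And>j. j < i \<Longrightarrow> w j = w' j"
    then have "feasible_pairs P Q (fst \<circ> w) (snd \<circ> w) i = feasible_pairs P Q (fst \<circ> w') (snd \<circ> w') i"
      by (auto simp: feasible_pairs_def)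
    then show "good w i z = good w' i z" by (simp add: good_def)
  next
    fix i and w :: "nat \<Rightarrow> 'a \<times> 'a"
    assume IH: "\<And>j. j < i \<Longrightarrow> good w j (w j)"
    show "\<exists>z. good w i z"
    proof (cases "i \<in> {1..n}")
      case True
      let ?F = "feasible_pairs P Q (fst \<circ> w) (snd \<circ> w) i"
      have "\<forall>j\<in>{1..<i}. (fst \<circ> w) j \<in> P \<and> (snd \<circ> w) j \<in> Q"
      proof
        fix j assume "j \<in> {1..<i}"
        then have "w j \<in> feasible_pairs P Q (fst \<circ> w) (snd \<circ> w) j"
          using IH[of j] True by (auto simp: good_def)
        then show "(fst \<circ> w) j \<in> P \<and> (snd \<circ> w) j \<in> Q"
          by (auto simp: feasible_pairs_def)
      qed
      then have "?F \<noteq> {}" using feasible_pairs_nonempty[OF P Q True] by blast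
      moreover have "compact ?F"
        using P Q by (intro compact_feasible_pairs) (auto simp: grassmannian_def)
      moreover have "continuous_on ?F (\<lambda>z. fst z \<bullet> snd z)" by (intro continuous_intros)
      ultimately obtain z where "z \<in> ?F" "\<forall>y\<in>?F. fst y \<bullet> snd y \<le> fst z \<bullet> snd z"
        using continuous_attains_sup by blast
      then show ?thesis unfolding good_def by (intro exI[of _ z]) auto
    qed (auto simp: good_def)
  qed
  then obtain w where w: "\<And>i. good w i (w i)" by blast
  define u v where "u = fst \<circ> w" and "v = snd \<circ> w"
  have feas: "(u i, v i) \<in> feasible_pairs P Q u v i"
    and opt: "\<forall>(x, y)\<in>feasible_pairs P Q u v i. x \<bullet> y \<le> u i \<bullet> v i" if "i \<in> {1..n}" for i
    using w[of i] that by (auto simp: good_def u_def v_def)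
  \<comment> \<open>Replacing \<open>v i\<close> by its negative keeps the pair feasible, so the
    maximum is nonnegative and its \<open>arccos\<close> is at most \<open>pi / 2\<close>.\<close>
  have ge0: "0 \<le> u i \<bullet> v i" if i: "i \<in> {1..n}" for i
  proof -
    have "(u i, - v i) \<in> feasible_pairs P Q u v i"
      using feas[OF i] Q by (auto simp: feasible_pairs_def grassmannian_def subspace_neg)
    then show ?thesis using opt[OF i] by fastforce
  qed
  have le1: "u i \<bullet> v i \<le> 1" if i: "i \<in> {1..n}" for i
    using feas[OF i] norm_cauchy_schwarz[of "u i" "v i"] by (auto simp: feasible_pairs_def norm_eq_1[symmetric])
  have "principal_angles n P Q (\<lambda>i. arccos (u i \<bullet> v i))"
    unfolding principal_angles_def
  proof (rule exI[of _ u], rule exI[of _ v], intro ballI conjI)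
    fix i assume i: "i \<in> {1..n}"
    show "0 \<le> arccos (u i \<bullet> v i)" "arccos (u i \<bullet> v i) \<le> pi / 2"
      "cos (arccos (u i \<bullet> v i)) = u i \<bullet> v i"
      using ge0[OF i] le1[OF i] arccos_le_pi2[of "u i \<bullet> v i"] by (auto intro: arccos_lbound cos_arccos)
    show "(u i, v i) \<in> feasible_pairs P Q u v i" by (rule feas[OF i])
    show "case z of (x, y) \<Rightarrow> x \<bullet> y \<le> u i \<bullet> v i" if "z \<in> feasible_pairs P Q u v i" for z
      using opt[OF i] that by blast
  qed
  then show ?thesis by blast
qed

text \<open>Rotating \<open>v\<close> in the plane spanned by \<open>v\<close> and \<open>w\<close> would increase \<open>u \<bullet> v\<close> unless \<open>u \<bullet> w = 0\<close>.\<close>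
lemma inner_eq_0_if_maximal:
  fixes u v w :: "'a::real_inner"
  assumes v: "v \<bullet> v = 1" and w: "w \<bullet> w = 1" and vw: "v \<bullet> w = 0" and "0 \<le> u \<bullet> v"
    and max: "\<And>a b. a\<^sup>2 + b\<^sup>2 = 1 \<Longrightarrow> u \<bullet> (a *\<^sub>R v + b *\<^sub>R w) \<le> u \<bullet> v"
  shows "u \<bullet> w = 0"
proof (rule ccontr)
  assume nz: "u \<bullet> w \<noteq> 0"
  \<comment> \<open>\<open>s\<close> is the length of the projection of \<open>u\<close> to the
    plane of \<open>v\<close> and \<open>w\<close>. The unit vector in that direction has inner
    product \<open>s\<close> with \<open>u\<close>, which exceeds \<open>u \<bullet> v\<close>
    unless \<open>u \<bullet> w = 0\<close>.\<close>
  define s where "s = sqrt ((u \<bullet> v)\<^sup>2 + (u \<bullet> w)\<^sup>2)"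
  have s2: "s\<^sup>2 = (u \<bullet> v)\<^sup>2 + (u \<bullet> w)\<^sup>2" by (simp add: s_def)
  have "0 < (u \<bullet> v)\<^sup>2 + (u \<bullet> w)\<^sup>2" using nz by (simp add: add_nonneg_pos)
  then have s: "0 < s" by (simp add: s_def)
  have "((u \<bullet> v) / s)\<^sup>2 + ((u \<bullet> w) / s)\<^sup>2 = 1"
    using s s2 nz by (simp add: power_divide flip: add_divide_distrib)
  then have "u \<bullet> (((u \<bullet> v) / s) *\<^sub>R v + ((u \<bullet> w) / s) *\<^sub>R w) \<le> u \<bullet> v" by (rule max)
  moreover have "u \<bullet> (((u \<bullet> v) / s) *\<^sub>R v + ((u \<bullet> w) / s) *\<^sub>R w) = s"
    using s s2 by (simp add: inner_add_right field_simps power2_eq_square)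
  ultimately have "s\<^sup>2 \<le> (u \<bullet> v)\<^sup>2" using s by (intro power_mono) auto
  then show False using s2 nz by simp
qed

lemma principal_vectors:
  fixes P Q :: "'a::euclidean_space set"
  assumes P: "P \<in> grassmannian n" and Q: "Q \<in> grassmannian n" and \<theta>: "principal_angles n P Q \<theta>"
  obtains u v where "orthonormal_basis n P u" "orthonormal_basis n Q v"
    "\<And>i j. i \<in> {1..n} \<Longrightarrow> j \<in> {1..n} \<Longrightarrow> u i \<bullet> v j = (if i = j then cos (\<theta> i) else 0)"
proof -
  have sP: "subspace P" "dim P = n" and sQ: "subspace Q" "dim Q = n"
    using P Q by (auto simp: grassmannian_def)
  from \<theta> obtain u v where uv: "\<And>i. i\<in>{1..n} \<Longrightarrow>
        0 \<le> \<theta> i \<and> \<theta> i \<le> pi / 2 \<and>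
        (u i, v i) \<in> feasible_pairs P Q u v i \<and>
        cos (\<theta> i) = u i \<bullet> v i \<and>
        (\<forall>(x, y)\<in>feasible_pairs P Q u v i. x \<bullet> y \<le> u i \<bullet> v i)"
    unfolding principal_angles_def by blast
  have feas: "u i \<in> P" "v i \<in> Q" "u i \<bullet> u i = 1" "v i \<bullet> v i = 1"
     "\<And>j. j \<in> {1..<i} \<Longrightarrow> u i \<bullet> u j = 0 \<and> v i \<bullet> v j = 0" if "i \<in> {1..n}" for i
    using uv[OF that] by (auto simp: feasible_pairs_def)
  have ge0: "0 \<le> u i \<bullet> v i" if "i \<in> {1..n}" for i
    using uv[OF that] cos_ge_zero[of "\<theta> i"] by auto
  have on: "u i \<bullet> u j = (if i = j then 1 else 0) \<and> v i \<bullet> v j = (if i = j then 1 else 0)"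
    if "i \<in> {1..n}" "j \<in> {1..n}" for i j
  proof (cases i j rule: linorder_cases)
    case less then show ?thesis using feas(5)[of j i] that by (simp add: inner_commute)
  next
    case greater then show ?thesis using feas(5)[of i j] that by simp
  qed (use feas(3,4)[of i] that in auto)
  have opt: "x \<bullet> y \<le> u i \<bullet> v i" if "i \<in> {1..n}" "(x, y) \<in> feasible_pairs P Q u v i" for i x y
    using uv[OF that(1)] that(2) by blast
  \<comment> \<open>The vectors of index \<open>j > i\<close> satisfy the constraints of stage
    \<open>i\<close> too, so the maximum at stage \<open>i\<close> also competes with rotations of
    \<open>v i\<close> towards \<open>v j\<close> and of \<open>u i\<close> towards
    \<open>u j\<close>.\<close>
  have less0: "u i \<bullet> v j = 0 \<and> v i \<bullet> u j = 0" if ij: "i \<in> {1..n}" "j \<in> {1..n}" "i < j" for i j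
  proof
    have perp: "u i \<bullet> u k = 0" "u j \<bullet> u k = 0" "v i \<bullet> v k = 0" "v j \<bullet> v k = 0" if "k \<in> {1..<i}" for k
      using on[of i k] on[of j k] that ij by auto
    have unit: "u i \<bullet> u i = 1" "u j \<bullet> u j = 1" "u i \<bullet> u j = 0" "v i \<bullet> v i = 1" "v j \<bullet> v j = 1" "v i \<bullet> v j = 0"
      using on[of i i] on[of j j] on[of i j] ij by auto
    have comb: "(a *\<^sub>R x + b *\<^sub>R y) \<bullet> (a *\<^sub>R x + b *\<^sub>R y) = 1"
      if "a\<^sup>2 + b\<^sup>2 = 1" "x \<bullet> x = 1" "y \<bullet> y = 1" "x \<bullet> y = 0" for a b and x y :: 'a
      using that by (simp add: inner_add_left inner_add_right inner_commute[of y x] power2_eq_square)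
    show "u i \<bullet> v j = 0"
    proof (rule inner_eq_0_if_maximal[of "v i"])
      fix a b :: real assume ab: "a\<^sup>2 + b\<^sup>2 = 1"
      have "(u i, a *\<^sub>R v i + b *\<^sub>R v j) \<in> feasible_pairs P Q u v i"
        using feas(1)[of i] feas(2)[of i] feas(2)[of j] ij perp unit comb[OF ab unit(4-6)] sQ(1)
        by (auto simp: feasible_pairs_def inner_add_left subspace_add subspace_scale)
      then show "u i \<bullet> (a *\<^sub>R v i + b *\<^sub>R v j) \<le> u i \<bullet> v i" by (rule opt[OF ij(1)])
    qed (use unit ge0[OF ij(1)] in auto)
    show "v i \<bullet> u j = 0"
    proof (rule inner_eq_0_if_maximal[of "u i"])
      fix a b :: real assume ab: "a\<^sup>2 + b\<^sup>2 = 1"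
      have "(a *\<^sub>R u i + b *\<^sub>R u j, v i) \<in> feasible_pairs P Q u v i"
        using feas(2)[of i] feas(1)[of i] feas(1)[of j] ij perp unit comb[OF ab unit(1-3)] sP(1)
        by (auto simp: feasible_pairs_def inner_add_left subspace_add subspace_scale)
      then show "v i \<bullet> (a *\<^sub>R u i + b *\<^sub>R u j) \<le> v i \<bullet> u i"
        by (subst (1 2) inner_commute) (rule opt[OF ij(1)])
    qed (use unit ge0[OF ij(1)] inner_commute[of "u i" "v i"] in auto)
  qed
  show thesis
  proof
    show "orthonormal_basis n P u" using on sP feas by (intro orthonormal_basisI) auto
    show "orthonormal_basis n Q v" using on sQ feas by (intro orthonormal_basisI) auto
    show "u i \<bullet> v j = (if i = j then cos (\<theta> i) else 0)" if "i \<in> {1..n}" "j \<in> {1..n}" for i j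
    proof (cases i j rule: linorder_cases)
      case less then show ?thesis using less0[OF that] by simp
    next
      case greater then show ?thesis using less0[OF that(2,1)] by (simp add: inner_commute)
    qed (use uv[of i] that in auto)
  qed
qed

text \<open>The value does not depend on which angles \<open>SOME\<close> selects, because the sum
  of their squared cosines is the inner product of the two projection matrices.\<close>

lemma chordal_dist_eq_inner:
  fixes P Q :: "(real^'m) set"
  assumes P: "P \<in> grassmannian n" and Q: "Q \<in> grassmannian n"
  shows "(chordal_dist n P Q)\<^sup>2
    = real n * (real CARD('m) - real n) / real CARD('m) - plane_point n P \<bullet> plane_point n Q"
proof -
  define \<theta> where "\<theta> = (SOME \<theta>. principal_angles n P Q \<theta>)"
  have "principal_angles n P Q \<theta>"
    unfolding \<theta>_def using principal_angles_exist[OF P Q] by (rule someI_ex)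
  then obtain u v where uv: "orthonormal_basis n P u" "orthonormal_basis n Q v"
    "\<And>i j. i \<in> {1..n} \<Longrightarrow> j \<in> {1..n} \<Longrightarrow> u i \<bullet> v j = (if i = j then cos (\<theta> i) else 0)"
    using principal_vectors[OF P Q] by blast
  have "(\<Sum>i=1..n. \<Sum>j=1..n. (u i \<bullet> v j)\<^sup>2) = (\<Sum>i=1..n. \<Sum>j=1..n. if i = j then (cos (\<theta> i))\<^sup>2 else 0)"
    using uv(3) by (intro sum.cong) auto
  also have "\<dots> = (\<Sum>i=1..n. (cos (\<theta> i))\<^sup>2)" by (intro sum.cong) auto
  finally have "plane_point n P \<bullet> plane_point n Q = (\<Sum>i=1..n. (cos (\<theta> i))\<^sup>2) - (real n)\<^sup>2 / real CARD('m)"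
    using inner_plane_point[OF uv(1,2)] by simp
  moreover have "(chordal_dist n P Q)\<^sup>2 = (\<Sum>i=1..n. (sin (\<theta> i))\<^sup>2)"
    by (simp add: chordal_dist_def \<theta>_def[symmetric] sum_nonneg)
  moreover have "(\<Sum>i=1..n. (sin (\<theta> i))\<^sup>2) = real n - (\<Sum>i=1..n. (cos (\<theta> i))\<^sup>2)"
    by (simp add: sin_squared_eq sum_subtractf)
  moreover have "real n * (real CARD('m) - real n) / real CARD('m) = real n - (real n)\<^sup>2 / real CARD('m)"
    by (simp add: field_simps power2_eq_square)
  ultimately show ?thesis by simp
qed

text \<open>The principal vectors of \<open>P\<close> with itself provide the basis.\<close>

lemma grassmannian_orthonormal_basis:
  assumes "P \<in> grassmannian n"
  obtains u where "orthonormal_basis n P u"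
  using principal_angles_exist[OF assms assms] principal_vectors[OF assms assms] by metis

lemma inner_plane_point_self:
  fixes P :: "(real^'m) set"
  assumes "P \<in> grassmannian n"
  shows "plane_point n P \<bullet> plane_point n P = real n * (real CARD('m) - real n) / real CARD('m)"
proof -
  obtain u where u: "orthonormal_basis n P u" using grassmannian_orthonormal_basis[OF assms] .
  have "(\<Sum>i=1..n. \<Sum>j=1..n. (u i \<bullet> u j)\<^sup>2) = (\<Sum>i=1..n. \<Sum>j=1..n. if i = j then 1 else 0)"
    using u by (intro sum.cong) (auto simp: orthonormal_basis_def)
  also have "\<dots> = real n" by simp
  finally show ?thesis
    by (simp add: inner_plane_point[OF u u] field_simps power2_eq_square)
qed

section \<open>The space of traceless symmetric matrices\<close>

lemma subspace_sym_traceless: "subspace (sym_traceless :: (real^'m^'m) set)"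
  by (auto simp: subspace_def sym_traceless_def transpose_def trace_def vec_eq_iff sum.distrib
      simp flip: sum_distrib_left)

text \<open>Symmetric matrices are spanned by the matrices \<open>G {i, j}\<close> supported on the entries
  \<open>(i, j)\<close> and \<open>(j, i)\<close>, indexed by the subsets of the index type with one or two elements; the
  identity matrix shows that trace \<open>0\<close> costs one more dimension.\<close>
lemma dim_sym_traceless_le:
  "dim (sym_traceless :: (real^'m^'m) set) \<le> ((CARD('m) + 1) choose 2) - 1"
proof -
  define S :: "(real^'m^'m) set" where "S = {M. transpose M = M}"
  define G :: "'m set \<Rightarrow> real^'m^'m" where "G s = (\<chi> i j. if {i, j} = s then 1 else 0)" for s
  define K :: "'m set set" where "K = {s. s \<subseteq> UNIV \<and> card s = 1} \<union> {s. s \<subseteq> UNIV \<and> card s = 2}"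
  have "card K = card {s :: 'm set. s \<subseteq> UNIV \<and> card s = 1} + card {s :: 'm set. s \<subseteq> UNIV \<and> card s = 2}"
    unfolding K_def by (intro card_Un_disjoint) auto
  also have "\<dots> = (CARD('m) choose 1) + (CARD('m) choose 2)"
    by (simp only: n_subsets[OF finite_class.finite_UNIV])
  also have "\<dots> = (CARD('m) + 1) choose 2" by (simp add: numeral_2_eq_2)
  finally have cK: "card K = (CARD('m) + 1) choose 2" .
  have inK: "{i, j} \<in> K" for i j :: 'm
    by (cases "i = j") (auto simp: K_def)
  have "S \<subseteq> span (G ` K)"
  proof
    fix M :: "real^'m^'m" assume M: "M \<in> S"
    have sym: "M $ i $ j = M $ j $ i" for i j
    proof -
      have "transpose M $ i $ j = M $ i $ j" using M by (simp add: S_def)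
      then show ?thesis by (simp add: transpose_def)
    qed
    \<comment> \<open>By symmetry the entry of \<open>M\<close> at \<open>(i, j)\<close> depends
      only on the unordered pair, so \<open>THE\<close> has a unique value at
      \<open>{i, j}\<close>.\<close>
    define c where "c s = (THE t. \<forall>i j. {i, j} = s \<longrightarrow> t = M $ i $ j)" for s
    have c: "c {i, j} = M $ i $ j" for i j
      unfolding c_def using sym by (intro the_equality) (auto simp: doubleton_eq_iff)
    have "M = (\<Sum>s\<in>K. c s *\<^sub>R G s)"
    proof (simp add: vec_eq_iff, intro allI)
      fix i j
      have "(\<Sum>s\<in>K. c s * G s $ i $ j) = (\<Sum>s\<in>K. if s = {i, j} then c s else 0)"
        by (intro sum.cong) (auto simp: G_def)
      also have "\<dots> = M $ i $ j" using inK c by simp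
      finally show "M $ i $ j = (\<Sum>s\<in>K. c s * G s $ i $ j)" by simp
    qed
    then show "M \<in> span (G ` K)"
      by (metis (no_types, lifting) span_sum span_scale span_base imageI)
  qed
  then have "dim S \<le> card (G ` K)" by (intro dim_le_card) auto
  also have "\<dots> \<le> card K" by (rule card_image_le) simp
  finally have S: "dim S \<le> (CARD('m) + 1) choose 2" using cK by simp
  have sub: "sym_traceless \<subseteq> S" by (auto simp: sym_traceless_def S_def)
  have "subspace S" by (auto simp: subspace_def S_def transpose_def vec_eq_iff)
  moreover have "(mat 1 :: real^'m^'m) \<in> S - sym_traceless"
    by (auto simp: S_def sym_traceless_def transpose_mat trace_I)
  ultimately have "span (sym_traceless :: (real^'m^'m) set) \<subset> span S"
    using sub subspace_sym_traceless by (metis DiffE psubsetI span_eq_iff)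
  then have "dim (sym_traceless :: (real^'m^'m) set) < dim S" by (rule dim_psubset)
  then show ?thesis using S by simp
qed

section \<open>Rankin's bounds\<close>

lemma inner_sum_self:
  fixes x :: "'i \<Rightarrow> 'a::real_inner"
  assumes "finite I"
  shows "(\<Sum>i\<in>I. x i) \<bullet> (\<Sum>i\<in>I. x i) = (\<Sum>i\<in>I. x i \<bullet> x i) + (\<Sum>i\<in>I. \<Sum>j\<in>I - {i}. x i \<bullet> x j)"
proof -
  have "(\<Sum>i\<in>I. x i) \<bullet> (\<Sum>i\<in>I. x i) = (\<Sum>i\<in>I. \<Sum>j\<in>I. x i \<bullet> x j)"
    by (simp only: inner_sum_left) (simp only: inner_sum_right)
  also have "\<dots> = (\<Sum>i\<in>I. x i \<bullet> x i + (\<Sum>j\<in>I - {i}. x i \<bullet> x j))"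
    using assms by (intro sum.cong sum.remove) auto
  finally show ?thesis by (simp add: sum.distrib)
qed

text \<open>With \<open>N = card I\<close>, the slacks \<open>s - x i \<bullet> x j\<close> and the
  square of the sum are nonnegative and add up to \<open>N * (R + (N - 1) * s)\<close>. The bound
  says that this total is nonnegative; if it is zero, every slack and the sum vanish.\<close>

lemma simplex_bound:
  fixes x :: "'i \<Rightarrow> 'a::real_inner"
  assumes I: "finite I" "2 \<le> card I"
    and norm: "\<And>i. i \<in> I \<Longrightarrow> x i \<bullet> x i = R"
    and le: "\<And>i j. i \<in> I \<Longrightarrow> j \<in> I \<Longrightarrow> i \<noteq> j \<Longrightarrow> x i \<bullet> x j \<le> s"
  shows "- R / (real (card I) - 1) \<le> s"
    and "s = - R / (real (card I) - 1) \<Longrightarrow>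
      (\<Sum>i\<in>I. x i) = 0 \<and> (\<forall>i\<in>I. \<forall>j\<in>I. i \<noteq> j \<longrightarrow> x i \<bullet> x j = s)"
proof -
  let ?N = "real (card I)" and ?X = "\<Sum>i\<in>I. x i"
  have X: "?X \<bullet> ?X = ?N * R + (\<Sum>i\<in>I. \<Sum>j\<in>I - {i}. x i \<bullet> x j)"
    using inner_sum_self[OF I(1), of x] norm by simp
  have "(\<Sum>i\<in>I. \<Sum>j\<in>I - {i}. s) = (\<Sum>i\<in>I. (?N - 1) * s)"
    using I by (intro sum.cong) (auto simp: of_nat_diff)
  then have const: "(\<Sum>i\<in>I. \<Sum>j\<in>I - {i}. s) = ?N * ((?N - 1) * s)" by simp
  have gap: "(\<Sum>i\<in>I. \<Sum>j\<in>I - {i}. s - x i \<bullet> x j) + ?X \<bullet> ?X = ?N * (R + (?N - 1) * s)"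
    unfolding X by (simp only: sum_subtractf const) (simp only: algebra_simps)
  have pos: "0 \<le> (\<Sum>i\<in>I. \<Sum>j\<in>I - {i}. s - x i \<bullet> x j)" using le by (intro sum_nonneg) auto
  have N: "0 < ?N" "0 < ?N - 1" using I(2) by auto
  have "0 \<le> ?N * (R + (?N - 1) * s)" using gap pos inner_ge_zero[of ?X] by linarith
  then have "0 \<le> R + (?N - 1) * s" using N(1) by (simp add: zero_le_mult_iff)
  then show "- R / (?N - 1) \<le> s" using N(2) by (simp add: field_simps)
  assume "s = - R / (?N - 1)"
  then have "R + (?N - 1) * s = 0" using N(2) by simp
  then have "?N * (R + (?N - 1) * s) = 0" by simp
  then have 0: "(\<Sum>i\<in>I. \<Sum>j\<in>I - {i}. s - x i \<bullet> x j) = 0" "?X \<bullet> ?X = 0"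
    using gap pos inner_ge_zero[of ?X] by linarith+
  have le': "0 \<le> s - x i \<bullet> x j" if "i \<in> I" "j \<in> I - {i}" for i j
    using le[of i j] that by auto
  have "x i \<bullet> x j = s" if i: "i \<in> I" and j: "j \<in> I - {i}" for i j
  proof -
    have "(\<Sum>j\<in>I - {i}. s - x i \<bullet> x j) = 0"
      by (rule sum_nonneg_0[OF I(1) _ 0(1) i]) (rule sum_nonneg, rule le')
    then have "s - x i \<bullet> x j = 0"
      by (rule sum_nonneg_0[rotated 2]) (use I(1) i j le' in blast)+
    then show ?thesis by simp
  qed
  moreover have "?X = 0" using 0(2) by (simp only: inner_eq_zero_iff)
  ultimately show "?X = 0 \<and> (\<forall>i\<in>I. \<forall>j\<in>I. i \<noteq> j \<longrightarrow> x i \<bullet> x j = s)"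
    by blast
qed

text \<open>Since the coefficients of an affine relation add up to zero, its inner product with
  \<open>x k\<close> leaves only \<open>c (x k) * (R - s)\<close>.\<close>

lemma equiangular_affine_independent:
  fixes x :: "'i \<Rightarrow> 'a::real_inner"
  assumes I: "finite I" and norm: "\<And>i. i \<in> I \<Longrightarrow> x i \<bullet> x i = R"
    and eq: "\<And>i j. i \<in> I \<Longrightarrow> j \<in> I \<Longrightarrow> i \<noteq> j \<Longrightarrow> x i \<bullet> x j = s" and "s \<noteq> R"
  shows "inj_on x I" "\<not> affine_dependent (x ` I)"
proof -
  show inj: "inj_on x I" using assms by (metis inj_onI)
  show "\<not> affine_dependent (x ` I)"
  proof
    assume "affine_dependent (x ` I)"
    then obtain c where c: "sum c (x ` I) = 0" "(\<Sum>v\<in>x ` I. c v *\<^sub>R v) = 0"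
      and nz: "\<exists>v\<in>x ` I. c v \<noteq> 0"
      using affine_dependent_explicit_finite[of "x ` I"] I by auto
    then obtain k where k: "k \<in> I" "c (x k) \<noteq> 0" by auto
    have c0: "(\<Sum>i\<in>I. c (x i)) = 0" using c(1) inj by (simp add: sum.reindex)
    have "0 = (\<Sum>i\<in>I. c (x i) *\<^sub>R x i) \<bullet> x k"
      using c(2) inj by (simp add: sum.reindex)
    also have "\<dots> = (\<Sum>i\<in>I. c (x i) * s + (if i = k then c (x i) * (R - s) else 0))"
      unfolding inner_sum_left using norm eq k by (intro sum.cong) (auto simp: algebra_simps)
    also have "\<dots> = c (x k) * (R - s)"
      using c0 k I by (simp add: sum.distrib flip: sum_distrib_right)
    finally show False using k \<open>s \<noteq> R\<close> by simp
  qed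
qed

text \<open>By Radon's theorem more than \<open>dim V + 1\<close> vectors split into two parts whose convex hulls
  share a point \<open>z\<close>; if all inner products were negative, then \<open>z \<bullet> z < 0\<close>.\<close>
lemma card_le_if_inner_neg:
  fixes S :: "'a::euclidean_space set"
  assumes S: "finite S" "S \<subseteq> V" "subspace V"
    and neg: "\<And>x y. x \<in> S \<Longrightarrow> y \<in> S \<Longrightarrow> x \<noteq> y \<Longrightarrow> x \<bullet> y < 0"
  shows "card S \<le> dim V + 1"
proof (rule ccontr)
  assume "\<not> card S \<le> dim V + 1"
  then have "dim S + 2 \<le> card S" using dim_subset[OF S(2)] by simp
  then have "affine_dependent S" using affine_dependent_biggerset_general[OF S(1)] by simp
  then obtain A B where AB: "A \<inter> B = {}" "A \<union> B = S" "convex hull A \<inter> convex hull B \<noteq> {}"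
    using Radon_partition[OF S(1)] by blast
  then obtain z where z: "z \<in> convex hull A" "z \<in> convex hull B" by blast
  \<comment> \<open>Open half-spaces are convex, so the strict inequality passes to convex hulls:
    first to that of \<open>A\<close> for fixed \<open>b\<close>, then to that of \<open>B\<close>
    for fixed \<open>z\<close>.\<close>
  have "b \<bullet> z < 0" if "b \<in> B" for b
  proof -
    have "A \<subseteq> {a. b \<bullet> a < 0}" using neg AB that by blast
    then have "convex hull A \<subseteq> {a. b \<bullet> a < 0}" by (rule hull_minimal) (rule convex_halfspace_lt)
    then show ?thesis using z by blast
  qed
  then have "B \<subseteq> {b. z \<bullet> b < 0}" by (auto simp: inner_commute)
  then have "convex hull B \<subseteq> {b. z \<bullet> b < 0}" by (rule hull_minimal) (rule convex_halfspace_lt)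
  then have "z \<bullet> z < 0" using z by blast
  then show False using inner_ge_zero[of z] by linarith
qed

text \<open>Projecting the other vectors of \<open>S\<close> to the hyperplane orthogonal to \<open>x\<close> keeps their inner
  products nonpositive, is injective away from \<open>0\<close>, and kills at most one of them, which is then a
  negative multiple of \<open>x\<close>. So a drop of one dimension costs at most two vectors.\<close>
lemma card_le_if_inner_nonpos_step:
  fixes S V :: "'a::euclidean_space set"
  assumes IH: "\<And>(W :: 'a set) T. dim W < dim V \<Longrightarrow> finite T \<Longrightarrow> subspace W \<Longrightarrow> T \<subseteq> W - {0} \<Longrightarrow>
        (\<And>x y. x \<in> T \<Longrightarrow> y \<in> T \<Longrightarrow> x \<noteq> y \<Longrightarrow> x \<bullet> y \<le> 0) \<Longrightarrow> card T \<le> 2 * dim W"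
    and S: "finite S" "subspace V" "S \<subseteq> V - {0}"
    and np: "\<And>x y. x \<in> S \<Longrightarrow> y \<in> S \<Longrightarrow> x \<noteq> y \<Longrightarrow> x \<bullet> y \<le> 0"
    and x: "x \<in> S"
  shows "card S \<le> 2 * dim V"
    and "card S = 2 * dim V \<Longrightarrow> \<exists>c>0. - (c *\<^sub>R x) \<in> S"
proof -
  have xx: "0 < x \<bullet> x" using x S by auto
  define pr where "pr y = y - ((y \<bullet> x) / (x \<bullet> x)) *\<^sub>R x" for y
  define A where "A = {y \<in> S - {x}. pr y = 0}"
  define B where "B = {y \<in> S - {x}. pr y \<noteq> 0}"
  define W where "W = {y \<in> V. y \<bullet> x = 0}"
  have subW: "subspace W"
    using S(2) by (auto simp: W_def subspace_def inner_add_left)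
  have "x \<in> V - W" using x xx S by (auto simp: W_def)
  then have "span W \<subset> span V"
    using subW S(2) by (metis (no_types, lifting) DiffE W_def mem_Collect_eq psubsetI span_eq_iff subsetI)
  then have dimW: "dim W < dim V" by (rule dim_psubset)
  have pr_inner: "pr y \<bullet> pr z = y \<bullet> z - (y \<bullet> x) * (z \<bullet> x) / (x \<bullet> x)" for y z
  proof -
    have "pr y \<bullet> x = 0" using xx by (simp add: pr_def inner_diff_left)
    then have "pr y \<bullet> pr z = pr y \<bullet> z" by (simp add: pr_def[of z] inner_diff_right)
    then show ?thesis by (simp add: pr_def inner_diff_left inner_commute[of x z])
  qed
  have pr_np: "pr y \<bullet> pr z \<le> 0" if "y \<in> S - {x}" "z \<in> S - {x}" "y \<noteq> z" for y z
  proof -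
    \<comment> \<open>Both factors are nonpositive, so the projection subtracts a nonnegative term
      from \<open>y \<bullet> z\<close>.\<close>
    have "0 \<le> (y \<bullet> x) * (z \<bullet> x)" using np x that by (intro mult_nonpos_nonpos) auto
    then have "0 \<le> (y \<bullet> x) * (z \<bullet> x) / (x \<bullet> x)" by simp
    then show ?thesis using np[of y z] that by (simp add: pr_inner)
  qed
  have "inj_on pr B"
  proof (rule inj_onI, rule ccontr)
    \<comment> \<open>Distinct vectors with a common image would give this image a nonpositive
      square.\<close>
    fix y z assume yz: "y \<in> B" "z \<in> B" "pr y = pr z" "y \<noteq> z"
    then have "pr y \<bullet> pr y \<le> 0" using pr_np[of y z] by (auto simp: B_def)
    then have "pr y = 0" using inner_ge_zero[of "pr y"] by (metis inner_eq_zero_iff order_antisym)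
    then show False using yz(1) by (simp add: B_def)
  qed
  then have "card B = card (pr ` B)" by (simp add: card_image)
  also have "\<dots> \<le> 2 * dim W"
  proof (rule IH[OF dimW _ subW])
    show "pr ` B \<subseteq> W - {0}"
    proof
      fix p assume "p \<in> pr ` B"
      then obtain y where y: "y \<in> S" "p = pr y" "p \<noteq> 0" by (auto simp: B_def)
      have "p \<in> V"
        using x y S(2,3) unfolding y(2) pr_def by (intro subspace_diff subspace_scale) auto
      moreover have "p \<bullet> x = 0" using xx by (simp add: y(2) pr_def inner_diff_left)
      ultimately show "p \<in> W - {0}" using y(3) by (simp add: W_def)
    qed
    show "p \<bullet> q \<le> 0" if "p \<in> pr ` B" "q \<in> pr ` B" "p \<noteq> q" for p q
      using that pr_np by (auto simp: B_def)
  qed (use S in \<open>auto simp: B_def\<close>)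
  finally have cB: "card B \<le> 2 * dim W" .
  have A: "\<exists>c>0. y = - (c *\<^sub>R x)" if y: "y \<in> A" for y
  proof -
    obtain c where c: "y = c *\<^sub>R x" using y by (auto simp: A_def pr_def)
    have "y \<bullet> x \<le> 0" "y \<noteq> 0" using y np[of y x] x S by (auto simp: A_def)
    then have "c < 0" using c xx by (auto simp: mult_le_0_iff less_le)
    then show ?thesis using c by (intro exI[of _ "- c"]) simp
  qed
  have "\<forall>y\<in>A. \<forall>z\<in>A. y = z"
  proof (intro ballI, rule ccontr)
    fix y z assume yz: "y \<in> A" "z \<in> A" "y \<noteq> z"
    obtain c d where cd: "c > 0" "y = - (c *\<^sub>R x)" "d > 0" "z = - (d *\<^sub>R x)"
      using A yz by metis
    have "y \<bullet> z \<le> 0" using yz np by (auto simp: A_def)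
    moreover have "y \<bullet> z = c * (d * (x \<bullet> x))" using cd by simp
    moreover have "0 < c * (d * (x \<bullet> x))" using cd(1,3) xx by (intro mult_pos_pos)
    ultimately show False by linarith
  qed
  moreover have "finite A" using S(1) by (simp add: A_def)
  ultimately have cA: "card A \<le> 1"
    using card_le_Suc0_iff_eq[of A] by simp
  have "S = insert x (A \<union> B)" using x by (auto simp: A_def B_def)
  moreover have "x \<notin> A \<union> B" "A \<inter> B = {}" "finite A" "finite B"
    using S(1) by (auto simp: A_def B_def)
  ultimately have cS: "card S = 1 + card A + card B" by (simp add: card_Un_disjoint)
  show "card S \<le> 2 * dim V" using cA cB cS dimW by linarith
  show "\<exists>c>0. - (c *\<^sub>R x) \<in> S" if "card S = 2 * dim V"
  proof -
    \<comment> \<open>Here \<open>x\<close> and \<open>B\<close> account for at most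
      \<open>2 * dim V - 1\<close> vectors, so equality forces a vector in \<open>A\<close>, which
      is the required negative multiple.\<close>
    have "card A \<noteq> 0" using that cS cB dimW by linarith
    then obtain y where "y \<in> A" by (metis card.empty equals0I)
    then show ?thesis using A[of y] by (auto simp: A_def)
  qed
qed

lemma card_le_if_inner_nonpos:
  fixes S V :: "'a::euclidean_space set"
  assumes "finite S" "subspace V" "S \<subseteq> V - {0}"
    and "\<And>x y. x \<in> S \<Longrightarrow> y \<in> S \<Longrightarrow> x \<noteq> y \<Longrightarrow> x \<bullet> y \<le> 0"
  shows "card S \<le> 2 * dim V"
  using assms
proof (induction "dim V" arbitrary: S V rule: less_induct)
  case less
  show ?case
  proof (cases "S = {}")
    case False
    then obtain x where "x \<in> S" by blast
    then show ?thesis using card_le_if_inner_nonpos_step(1)[of V S x] less by blast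
  qed simp
qed

text \<open>The bound, now known in all dimensions, discharges the induction hypothesis of the step
  lemma and leaves its equality case.\<close>

lemma negative_multiple_if_card_eq:
  fixes S V :: "'a::euclidean_space set"
  assumes "finite S" "subspace V" "S \<subseteq> V - {0}"
    and "\<And>x y. x \<in> S \<Longrightarrow> y \<in> S \<Longrightarrow> x \<noteq> y \<Longrightarrow> x \<bullet> y \<le> 0"
    and "x \<in> S" "card S = 2 * dim V"
  shows "\<exists>c>0. - (c *\<^sub>R x) \<in> S"
  by (rule card_le_if_inner_nonpos_step(2)[OF card_le_if_inner_nonpos assms])

text \<open>To pass from sets to families, note that a repeated point already yields a pair with
  nonnegative inner product.\<close>

lemma inner_nonneg_if_card_gt:
  fixes x :: "'i \<Rightarrow> 'a::euclidean_space"
  assumes I: "finite I" "dim V + 1 < card I" and V: "subspace V" "\<And>i. i \<in> I \<Longrightarrow> x i \<in> V"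
  shows "\<exists>i\<in>I. \<exists>j\<in>I. i \<noteq> j \<and> 0 \<le> x i \<bullet> x j"
proof (rule ccontr)
  assume "\<not> ?thesis"
  then have neg: "x i \<bullet> x j < 0" if "i \<in> I" "j \<in> I" "i \<noteq> j" for i j
    using that by (meson not_less)
  have "inj_on x I"
  proof (rule inj_onI, rule ccontr)
    fix i j assume "i \<in> I" "j \<in> I" "x i = x j" "i \<noteq> j"
    then show False using neg[of i j] inner_ge_zero[of "x j"] by simp
  qed
  then have "card (x ` I) = card I" by (rule card_image)
  moreover have "card (x ` I) \<le> dim V + 1"
  proof (rule card_le_if_inner_neg[OF _ _ V(1)])
    show "y \<bullet> z < 0" if "y \<in> x ` I" "z \<in> x ` I" "y \<noteq> z" for y z
      using that neg by blast
  qed (use I V in auto)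
  ultimately show False using I(2) by simp
qed

text \<open>By the equality case every vector has its antipode in \<open>S\<close>, hence is orthogonal to all others;
  a maximal orthogonal subset of \<open>S\<close> contains one vector of each antipodal pair.\<close>
lemma inner_nonpos_imp_orthoplex:
  fixes x :: "nat \<Rightarrow> 'a::euclidean_space"
  assumes V: "subspace V" "dim V \<le> D" "\<And>i. i \<in> {1..2 * D} \<Longrightarrow> x i \<in> V" and r: "0 < r"
    and norm: "\<And>i. i \<in> {1..2 * D} \<Longrightarrow> x i \<bullet> x i = r\<^sup>2"
    and np: "\<And>i j. i \<in> {1..2 * D} \<Longrightarrow> j \<in> {1..2 * D} \<Longrightarrow> i \<noteq> j \<Longrightarrow> x i \<bullet> x j \<le> 0"
  shows "subset_of_regular_orthoplex r D V (2 * D) x"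
proof -
  define S where "S = x ` {1..2 * D}"
  have r2: "0 < r\<^sup>2" using r by simp
  have inj: "inj_on x {1..2 * D}"
    using norm np r2 by (metis inj_onI not_less)
  have cS: "card S = 2 * D" using inj by (simp add: S_def card_image)
  have S: "finite S" "S \<subseteq> V - {0}" using V(3) norm r2 by (force simp: S_def)+
  have nrm: "y \<bullet> y = r\<^sup>2" if "y \<in> S" for y using that norm by (auto simp: S_def)
  have np': "y \<bullet> z \<le> 0" if "y \<in> S" "z \<in> S" "y \<noteq> z" for y z
    using that np unfolding S_def by blast
  have "card S \<le> 2 * dim V" by (rule card_le_if_inner_nonpos[OF S(1) V(1) S(2) np'])
  then have dV: "dim V = D" using cS V(2) by simp
  have neg: "- y \<in> S" if y: "y \<in> S" for y
  proof -
    obtain c where c: "c > 0" "- (c *\<^sub>R y) \<in> S"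
      using negative_multiple_if_card_eq[OF S(1) V(1) S(2) np' y] cS dV by auto
    \<comment> \<open>All points have the same norm, so the negative multiple is the
      antipode.\<close>
    have "c * (c * r\<^sup>2) = r\<^sup>2" using nrm[OF c(2)] nrm[OF y] by simp
    then have "c\<^sup>2 = 1" using r by (simp add: power2_eq_square)
    then have "c = 1" using c(1) by (simp add: power2_eq_1_iff)
    then show ?thesis using c by simp
  qed
  \<comment> \<open>The inner products of \<open>z\<close> with \<open>y\<close> and with its
    antipode are both nonpositive.\<close>
  have orth: "y \<bullet> z = 0" if "y \<in> S" "z \<in> S" "z \<noteq> y" "z \<noteq> - y" for y z
    using np'[of y z] np'[of "- y" z] neg[of y] that by auto
  obtain E where E: "E \<subseteq> S" "pairwise orthogonal E"
    and max: "\<And>F. F \<subseteq> S \<Longrightarrow> pairwise orthogonal F \<Longrightarrow> E \<subseteq> F \<Longrightarrow> E = F"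
  proof -
    have "finite {F. F \<subseteq> S \<and> pairwise orthogonal F}" using S(1) by simp
    moreover have "{} \<in> {F. F \<subseteq> S \<and> pairwise orthogonal F}" by simp
    ultimately obtain E where "E \<in> {F. F \<subseteq> S \<and> pairwise orthogonal F}"
      "\<forall>F\<in>{F. F \<subseteq> S \<and> pairwise orthogonal F}. E \<subseteq> F \<longrightarrow> E = F"
      using finite_has_maximal by (metis (no_types, lifting) empty_iff)
    then show thesis using that[of E] by blast
  qed
  have cover: "y \<in> E \<or> - y \<in> E" if y: "y \<in> S" for y
  proof (rule ccontr)
    assume n: "\<not> (y \<in> E \<or> - y \<in> E)"
    have "y \<bullet> z = 0" if "z \<in> E" for z
      using orth[of y z] that n E(1) y by blast
    then have "pairwise orthogonal (insert y E)"
      using E(2) by (auto simp: pairwise_insert orthogonal_def inner_commute)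
    then have "E = insert y E" using max E(1) y by blast
    then show False using n by blast
  qed
  have finE: "finite E" using E(1) S(1) finite_subset by blast
  \<comment> \<open>Counting gives \<open>card E = D\<close>: \<open>E\<close> and its negatives
    cover the \<open>2 * D\<close> points, while \<open>E\<close> is independent in a space of
    dimension \<open>D\<close>.\<close>
  have "S \<subseteq> E \<union> uminus ` E" using cover by (metis UnCI image_eqI minus_minus subsetI)
  then have "card S \<le> card (E \<union> uminus ` E)" using finE by (intro card_mono) auto
  also have "\<dots> \<le> card E + card (uminus ` E)" by (rule card_Un_le)
  also have "\<dots> \<le> 2 * card E" using card_image_le[OF finE, of uminus] by simp
  finally have "D \<le> card E" using cS by simp
  moreover have "card E \<le> D"
  proof -
    have "independent E" using E S(2) by (intro pairwise_orthogonal_independent) auto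
    then show ?thesis using independent_card_le_dim[of E V] E(1) S(2) dV by auto
  qed
  ultimately have cE: "card E = D" by simp
  obtain h where h: "bij_betw h {1..D} E"
    using ex_bij_betw_nat_finite_1[OF finE] cE by auto
  define e where "e i = (1 / r) *\<^sub>R h i" for i
  have hE: "h i \<in> E" if "i \<in> {1..D}" for i using h that by (auto simp: bij_betw_def)
  have re: "r *\<^sub>R e i = h i" for i using r by (simp add: e_def)
  have "orthonormal_basis D V e"
  proof (rule orthonormal_basisI[OF _ V(1,2)])
    show "\<forall>i\<in>{1..D}. e i \<in> V"
      unfolding e_def using hE E(1) S(2) by (blast intro: subspace_scale[OF V(1)])
    show "\<forall>i\<in>{1..D}. \<forall>j\<in>{1..D}. e i \<bullet> e j = (if i = j then 1 else 0)"
    proof (intro ballI)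
      fix i j assume ij: "i \<in> {1..D}" "j \<in> {1..D}"
      have "h i \<bullet> h j = (if i = j then r\<^sup>2 else 0)"
      proof (cases "i = j")
        case True then show ?thesis using nrm hE[OF ij(1)] E(1) by auto
      next
        case False
        then have "h i \<noteq> h j" using h ij by (meson bij_betw_def inj_onD)
        then show ?thesis using False E(2) hE ij by (auto simp: pairwise_def orthogonal_def)
      qed
      then show "e i \<bullet> e j = (if i = j then 1 else 0)"
        using r by (simp add: e_def power2_eq_square)
    qed
  qed
  moreover have "x ` {1..2 * D} \<subseteq> (\<Union>i\<in>{1..D}. {r *\<^sub>R e i, - (r *\<^sub>R e i)})"
  proof
    fix y assume "y \<in> x ` {1..2 * D}"
    then have "y \<in> E \<or> - y \<in> E" using cover by (simp add: S_def)
    moreover have "E = h ` {1..D}" using h by (simp add: bij_betw_def)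
    ultimately obtain i where "i \<in> {1..D}" "y = h i \<or> - y = h i" by blast
    then show "y \<in> (\<Union>i\<in>{1..D}. {r *\<^sub>R e i, - (r *\<^sub>R e i)})"
      unfolding re by (metis UN_iff insertCI minus_minus)
  qed
  ultimately show ?thesis
    using inj unfolding subset_of_regular_orthoplex_def regular_orthoplex_vertices_def by blast
qed

section \<open>Orthoplexes and simplices in terms of inner products\<close>

text \<open>Distinct vertices are antipodal or orthogonal.\<close>

lemma orthoplex_inner_nonpos:
  assumes "regular_orthoplex_vertices r D V W" "a \<in> W" "b \<in> W" "a \<noteq> b"
  shows "a \<bullet> b \<le> 0"
proof -
  obtain e where on: "\<forall>i\<in>{1..D}. \<forall>j\<in>{1..D}. e i \<bullet> e j = (if i = j then 1 else 0)"
    and W: "W = (\<Union>i\<in>{1..D}. {r *\<^sub>R e i, - (r *\<^sub>R e i)})"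
    using assms(1) by (auto simp: regular_orthoplex_vertices_def orthonormal_basis_def)
  obtain i j where ij: "i \<in> {1..D}" "j \<in> {1..D}"
    and ab: "a = r *\<^sub>R e i \<or> a = - (r *\<^sub>R e i)" "b = r *\<^sub>R e j \<or> b = - (r *\<^sub>R e j)"
    using assms(2,3) W by auto
  show ?thesis
  proof (cases "i = j")
    case True
    then have "b = - a" using ab assms(4) by auto
    then show ?thesis by simp
  next
    case False
    then have "e i \<bullet> e j = 0" using on ij by simp
    then show ?thesis using ab by auto
  qed
qed

lemma inner_eq_dist:
  fixes x y :: "'a::real_inner"
  shows "x \<bullet> y = (x \<bullet> x + y \<bullet> y - (dist x y)\<^sup>2) / 2"
  by (simp add: dist_norm power2_norm_eq_inner inner_diff_left inner_diff_right inner_commute)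

lemma equiangular_imp_simplex:
  fixes x :: "nat \<Rightarrow> 'a::euclidean_space"
  assumes r: "0 \<le> r" and norm: "\<And>i. i \<in> {1..N} \<Longrightarrow> x i \<bullet> x i = r\<^sup>2"
    and eq: "\<And>i j. i \<in> {1..N} \<Longrightarrow> j \<in> {1..N} \<Longrightarrow> i \<noteq> j \<Longrightarrow> x i \<bullet> x j = s" and s: "s < r\<^sup>2"
    and sum: "(\<Sum>i=1..N. x i) = 0"
  shows "regular_equatorial_simplex r N x"
proof -
  have "x i \<in> sphere 0 r" if "i \<in> {1..N}" for i
    using norm[OF that] r by (simp add: norm_eq_sqrt_inner)
  moreover have "\<not> affine_dependent (x ` {1..N})"
    using s by (intro equiangular_affine_independent(2)[where R = "r\<^sup>2" and s = s] norm eq) auto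
  moreover have "dist (x i) (x j) = sqrt (2 * (r\<^sup>2 - s))" if "i \<in> {1..N}" "j \<in> {1..N}" "i \<noteq> j" for i j
  proof -
    have "(dist (x i) (x j))\<^sup>2 = 2 * (r\<^sup>2 - s)"
      using inner_eq_dist[of "x i" "x j"] norm eq that by simp
    then show ?thesis by (metis real_sqrt_unique zero_le_dist)
  qed
  moreover have "0 < sqrt (2 * (r\<^sup>2 - s))" using s by simp
  ultimately show ?thesis
    unfolding regular_equatorial_simplex_def using sum by (metis scaleR_zero_right)
qed

text \<open>Equal distances on a sphere give a common inner product, and the vanishing square of the
  sum determines its value.\<close>

lemma simplex_imp_equiangular:
  fixes x :: "nat \<Rightarrow> 'a::euclidean_space"
  assumes N: "2 \<le> N" and sim: "regular_equatorial_simplex r N x"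
    and ij: "i \<in> {1..N}" "j \<in> {1..N}" "i \<noteq> j"
  shows "x i \<bullet> x j = - r\<^sup>2 / (real N - 1)"
proof -
  from sim obtain t where "\<forall>i\<in>{1..N}. \<forall>j\<in>{1..N}. i \<noteq> j \<longrightarrow> dist (x i) (x j) = t"
    unfolding regular_equatorial_simplex_def by (elim conjE exE) rule
  then have t: "dist (x i) (x j) = t" if "i \<in> {1..N}" "j \<in> {1..N}" "i \<noteq> j" for i j
    using that by blast
  have sum: "(\<Sum>i=1..N. x i) = 0" and "\<And>i. i \<in> {1..N} \<Longrightarrow> norm (x i) = r"
    using sim N by (auto simp: regular_equatorial_simplex_def)
  then have norm: "x i \<bullet> x i = r\<^sup>2" if "i \<in> {1..N}" for i
    using that by (simp add: dot_square_norm)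
  define s where "s = (r\<^sup>2 + r\<^sup>2 - t\<^sup>2) / 2"
  have eq: "x i \<bullet> x j = s" if "i \<in> {1..N}" "j \<in> {1..N}" "i \<noteq> j" for i j
    using inner_eq_dist[of "x i" "x j"] norm t that by (simp add: s_def)
  have "(\<Sum>i=1..N. \<Sum>j\<in>{1..N} - {i}. x i \<bullet> x j) = (\<Sum>i=1..N. \<Sum>j\<in>{1..N} - {i}. s)"
    using eq by (intro sum.cong) auto
  also have "\<dots> = (\<Sum>i=1..N. (real N - 1) * s)"
    using N by (intro sum.cong) (auto simp: of_nat_diff)
  finally have "0 = real N * (r\<^sup>2 + (real N - 1) * s)"
    using inner_sum_self[of "{1..N}" x] norm sum by (simp add: algebra_simps)
  then have "r\<^sup>2 + (real N - 1) * s = 0" using N by simp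
  then show ?thesis using eq[OF ij] N by (simp add: field_simps)
qed

section \<open>The simplex and orthoplex bounds for planes\<close>

theorem mainTheorem2:
  fixes m n N D :: nat
    and P :: "nat \<Rightarrow> (real^'m) set"
    and dc2 r :: real
  assumes m_def: "m = CARD('m)" and m: "m \<ge> 2"
    and n: "1 \<le> n" "n \<le> m - 1"
    and N: "N \<ge> 2"
    and D_def: "D = ((m + 1) choose 2) - 1"
    and P: "\<forall>i\<in>{1..N}. P i \<in> grassmannian n"
    and dc2_def: "dc2 = Min {(chordal_dist n (P i) (P j))\<^sup>2 | i j. i \<in> {1..N} \<and> j \<in> {1..N} \<and> i \<noteq> j}"
    and r_def: "r = sqrt (real n * (real m - real n) / real m)"
  shows
    "(dc2 \<le> real n * (real m - real n) / real m * (real N / (real N - 1)) \<and>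
      (dc2 = real n * (real m - real n) / real m * (real N / (real N - 1)) \<longrightarrow>
         N \<le> (m + 1) choose 2) \<and>
      (dc2 = real n * (real m - real n) / real m * (real N / (real N - 1)) \<longleftrightarrow>
         regular_equatorial_simplex r N (\<lambda>i. plane_point n (P i)))) \<and>
     (N > (m + 1) choose 2 \<longrightarrow>
      dc2 \<le> real n * (real m - real n) / real m \<and>
      (dc2 = real n * (real m - real n) / real m \<longrightarrow> N \<le> (m - 1) * (m + 2)) \<and>
      (subset_of_regular_orthoplex r D sym_traceless N (\<lambda>i. plane_point n (P i)) \<longrightarrow>
         dc2 = real n * (real m - real n) / real m) \<and>
      (N = 2 * D \<and> dc2 = real n * (real m - real n) / real m \<longrightarrow>
         subset_of_regular_orthoplex r D sym_traceless N (\<lambda>i. plane_point n (P i))))"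
proof -
  define R where "R = real n * (real m - real n) / real m"
  define x where "x = (\<lambda>i. plane_point n (P i))"
  \<comment> \<open>\<open>s\<close> turns out to be the largest inner product of two distinct
    points, so every claim about \<open>dc2\<close> becomes one about \<open>s\<close>.\<close>
  define s where "s = R - dc2"
  let ?V = "sym_traceless :: (real^'m^'m) set"
  have "0 < real m - real n" using n m by linarith
  then have R: "0 < R" using n m by (simp add: R_def)
  then have r: "0 < r" "r\<^sup>2 = R" by (simp_all add: r_def R_def)
  have norm: "x i \<bullet> x i = R" if "i \<in> {1..N}" for i
    using inner_plane_point_self[of "P i" n] P that by (simp add: x_def R_def m_def)
  have xV: "x i \<in> ?V" if "i \<in> {1..N}" for i
    using grassmannian_orthonormal_basis[of "P i" n] plane_point_in_sym_traceless P that
    unfolding x_def by metis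
  have dimV: "dim ?V \<le> D" using dim_sym_traceless_le by (simp add: D_def m_def)
  \<comment> \<open>Positivity ensures that the truncated subtraction in \<open>D\<close> loses
    nothing.\<close>
  have "0 < (m + 1) choose 2" using m by (intro zero_less_binomial) simp
  then have D1: "D + 1 = (m + 1) choose 2" by (simp add: D_def)

  define A where "A = {(chordal_dist n (P i) (P j))\<^sup>2 | i j. i \<in> {1..N} \<and> j \<in> {1..N} \<and> i \<noteq> j}"
  have chord: "(chordal_dist n (P i) (P j))\<^sup>2 = R - x i \<bullet> x j" if "i \<in> {1..N}" "j \<in> {1..N}" for i j
    using chordal_dist_eq_inner[of "P i" n "P j"] P that by (simp add: x_def R_def m_def)
  have "A \<subseteq> (\<lambda>(i, j). (chordal_dist n (P i) (P j))\<^sup>2) ` ({1..N} \<times> {1..N})"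
    by (auto simp: A_def)
  then have finA: "finite A" by (rule finite_subset) simp
  have "(chordal_dist n (P 1) (P 2))\<^sup>2 \<in> A"
    unfolding A_def using N by (intro CollectI exI[of _ 1] exI[of _ 2]) auto
  then have "dc2 \<in> A" using Min_in[OF finA] dc2_def A_def by auto
  \<comment> \<open>A pair attaining the minimum carries the converse directions: the inner product
    that a simplex or orthoplex prescribes for it is information about \<open>s\<close>
    itself.\<close>
  then obtain i0 j0 where ij0: "i0 \<in> {1..N}" "j0 \<in> {1..N}" "i0 \<noteq> j0" and att: "x i0 \<bullet> x j0 = s"
    using chord unfolding A_def s_def by force
  have le: "x i \<bullet> x j \<le> s" if "i \<in> {1..N}" "j \<in> {1..N}" "i \<noteq> j" for i j
  proof -
    have "(chordal_dist n (P i) (P j))\<^sup>2 \<in> A" using that by (auto simp: A_def)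
    then have "dc2 \<le> (chordal_dist n (P i) (P j))\<^sup>2"
      unfolding dc2_def A_def[symmetric] by (rule Min_le[OF finA])
    then show ?thesis using chord that by (simp add: s_def)
  qed

  \<comment> \<open>The simplex bound and its equality case\<close>
  have N1: "0 < real N - 1" using N by simp
  have bound_eq: "R * (real N / (real N - 1)) = R - (- R / (real N - 1))"
    using N1 by (simp add: field_simps)
  have sbound: "- R / (real N - 1) \<le> s"
    using simplex_bound(1)[of "{1..N}" x R s] N norm le by simp
  have tight: "(\<Sum>i=1..N. x i) = 0 \<and> (\<forall>i\<in>{1..N}. \<forall>j\<in>{1..N}. i \<noteq> j \<longrightarrow> x i \<bullet> x j = s)"
    if "s = - R / (real N - 1)"
    using simplex_bound(2)[of "{1..N}" x R s] N norm le that by simp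
  \<comment> \<open>Affine independence and a positive edge length both rest on \<open>s\<close>
    differing from the squared radius.\<close>
  have s_less: "s < R" if "s = - R / (real N - 1)"
  proof -
    have "s < 0" using that R N1 by simp
    then show ?thesis using R by simp
  qed

  have i1: "dc2 \<le> R * (real N / (real N - 1))"
    using sbound unfolding bound_eq s_def by linarith
  have dc2_iff: "dc2 = R * (real N / (real N - 1)) \<longleftrightarrow> s = - R / (real N - 1)"
    unfolding bound_eq s_def by linarith
  have i2: "N \<le> (m + 1) choose 2" if "s = - R / (real N - 1)"
  proof -
    have ind: "inj_on x {1..N}" "\<not> affine_dependent (x ` {1..N})"
      using equiangular_affine_independent[of "{1..N}" x R s] norm tight[OF that] s_less[OF that] by auto
    \<comment> \<open>At least \<open>dim + 2\<close> points are always affinely dependent.\<close>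
    then have "\<not> card (x ` {1..N}) \<ge> dim (x ` {1..N}) + 2"
      using affine_dependent_biggerset_general[of "x ` {1..N}"] by blast
    then have "N < dim (x ` {1..N}) + 2" using ind(1) by (simp add: card_image)
    moreover have "dim (x ` {1..N}) \<le> dim ?V" using xV by (intro dim_subset) auto
    ultimately show ?thesis using dimV D1 by simp
  qed
  have i3: "s = - R / (real N - 1) \<longleftrightarrow> regular_equatorial_simplex r N x"
  proof
    assume s: "s = - R / (real N - 1)"
    then show "regular_equatorial_simplex r N x"
      using equiangular_imp_simplex[of r N x s] r norm tight[OF s] s_less[OF s] by auto
  next
    assume "regular_equatorial_simplex r N x"
    then show "s = - R / (real N - 1)"
      using simplex_imp_equiangular[of N r x i0 j0] N ij0 att r(2) by simp
  qed

  \<comment> \<open>The orthoplex bound and its equality cases\<close>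
  have ii: "0 \<le> s \<and> (s = 0 \<longrightarrow> N \<le> (m - 1) * (m + 2)) \<and>
      (subset_of_regular_orthoplex r D ?V N x \<longrightarrow> s = 0) \<and>
      (N = 2 * D \<and> s = 0 \<longrightarrow> subset_of_regular_orthoplex r D ?V N x)"
    if big: "N > (m + 1) choose 2"
  proof (intro conjI impI)
    have "dim ?V + 1 < card {1..N}" using big dimV D1 by simp
    then obtain i j where "i \<in> {1..N}" "j \<in> {1..N}" "i \<noteq> j" "0 \<le> x i \<bullet> x j"
      using inner_nonneg_if_card_gt[of "{1..N}" ?V x] subspace_sym_traceless xV by blast
    then show s0: "0 \<le> s" using le by (meson order_trans)
    show "N \<le> (m - 1) * (m + 2)" if "s = 0"
    proof -
      \<comment> \<open>Coinciding points would have inner product \<open>R > 0\<close>, against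
        \<open>s = 0\<close>.\<close>
      have "inj_on x {1..N}"
        using norm le R that by (metis inj_onI not_less)
      then have "card (x ` {1..N}) = N" by (simp add: card_image)
      moreover have "card (x ` {1..N}) \<le> 2 * dim ?V"
      proof (rule card_le_if_inner_nonpos[OF _ subspace_sym_traceless])
        show "x ` {1..N} \<subseteq> ?V - {0}" using xV norm R by force
        show "y \<bullet> z \<le> 0" if "y \<in> x ` {1..N}" "z \<in> x ` {1..N}" "y \<noteq> z" for y z
          using that le unfolding \<open>s = 0\<close> by blast
      qed simp
      ultimately show ?thesis using dimV twice_ambient_dim[OF m] by (simp add: D_def)
    qed
    show "s = 0" if "subset_of_regular_orthoplex r D ?V N x"
    proof -
      have "inj_on x {1..N}" and "\<exists>W. regular_orthoplex_vertices r D ?V W \<and> x ` {1..N} \<subseteq> W"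
        using that by (auto simp: subset_of_regular_orthoplex_def)
      \<comment> \<open>Injectivity makes the extremal pair two distinct vertices; this gives
        \<open>s \<le> 0\<close>, the reverse of the bound just proved.\<close>
      then have "x i0 \<bullet> x j0 \<le> 0"
        using ij0 orthoplex_inner_nonpos by (metis image_subset_iff inj_on_def)
      then show ?thesis using s0 att by simp
    qed
    show "subset_of_regular_orthoplex r D ?V N x" if "N = 2 * D \<and> s = 0"
      using inner_nonpos_imp_orthoplex[OF subspace_sym_traceless dimV, of x r] xV norm le r that
      by auto
  qed
  have s_iff: "dc2 \<le> R \<longleftrightarrow> 0 \<le> s" "dc2 = R \<longleftrightarrow> s = 0" by (auto simp: s_def)
  show ?thesis
    unfolding R_def[symmetric] x_def[symmetric]
    unfolding dc2_iff s_iff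
    using i1 i2 i3 ii by blast
qed

end
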